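(* Let $G$ and $B$ be finite sets. For each $g \in G$ let $B_g \subseteq B$ and for each $b \in B$ let $G_b \subseteq G$. Put $G_L = \{g \in G : B_g \neq \varnothing\}$ and $B_L = \{b \in B : G_b \neq \varnothing\}$. For $g \in G_L$ let $B^*_g = \{b \in B_g : b \notin B_L \text{ or } g \in G_b\}$, and for $b \in B_L$ let $G^*_b = \{g \in G_b : g \notin G_L \text{ or } b \in B_g\}$. Then there exists an injective partial function $P : G \to B$ with $G_L \subseteq \mathrm{Domain}(P)$, $B_L \subseteq \mathrm{Range}(P)$, $P(g) \in B_g$ for all $g \in G_L$, and $P^{-1}(b) \in G_b$ for all $b \in B_L$, if and only if both of the following hold: (i) there is an injective function $T_1 : G_L \to B$ with $T_1(g) \in B^*_g$ for all $g \in G_L$; (ii) there is an injective function $T_2 : B_L \to G$ with $T_2(b) \in G^*_b$ for all $b \in B_L$.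
   Context: This is the "Symmetric Marriage Problem": $G$ is a set of girls and $B$ a set of boys; $B_g$ is the list of boys girl $g$ is willing to marry and $G_b$ the list of girls boy $b$ is willing to marry. An empty list $B_g=\varnothing$ (resp. $G_b=\varnothing$) has the special meaning that $g$ (resp. $b$) has no list, i.e. is willing to marry anyone or no one; $G_L$ and $B_L$ are the sets of girls and boys who have lists. A partial function $P$ as in the claim is called a solution of the instance. *)

theory Defs
  imports Main "HOL-Library.FuncSet"
begin

text \<open>
  An instance of the symmetric marriage problem consists of sets \<open>G\<close> (girls) and \<open>B\<close> (boys)
  together with functions \<open>Bl\<close> and \<open>Gl\<close>: \<open>Bl g\<close> is the list of boys of \<open>g \<in> G\<close> and \<open>Gl b\<close> is the
  list of girls of \<open>b \<in> B\<close>, where an empty list means "no list, no restriction".  As the problem is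
  symmetric, the first two definitions serve both sides:
  \<open>G\<^sub>L = listed G Bl\<close>, \<open>B\<^sub>L = listed B Gl\<close>,
  \<open>B\<^sup>*\<^sub>g = star Bl B Gl g\<close> and \<open>G\<^sup>*\<^sub>b = star Gl G Bl b\<close>.
\<close>

definition listed :: "'x set \<Rightarrow> ('x \<Rightarrow> 'y set) \<Rightarrow> 'x set" where
  "listed X L = {x \<in> X. L x \<noteq> {}}"

definition star :: "('x \<Rightarrow> 'y set) \<Rightarrow> 'y set \<Rightarrow> ('y \<Rightarrow> 'x set) \<Rightarrow> 'x \<Rightarrow> 'y set" where
  "star L Y M x = {y \<in> L x. y \<notin> listed Y M \<or> x \<in> M y}"

text \<open>
  The partial function \<open>P : G \<rightarrow> B\<close> is a map.  Its injectivity is required on \<open>dom P\<close> only, as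
  several girls may be mapped to \<^const>\<open>None\<close>; \<open>P\<^sup>-\<^sup>1(b)\<close> is the inverse on \<open>dom P\<close>, which
  is meaningful for \<open>b \<in> ran P\<close>.
\<close>

definition is_solution ::
  "'g set \<Rightarrow> 'b set \<Rightarrow> ('g \<Rightarrow> 'b set) \<Rightarrow> ('b \<Rightarrow> 'g set) \<Rightarrow> ('g \<rightharpoonup> 'b) \<Rightarrow> bool" where
  "is_solution G B Bl Gl P \<longleftrightarrow>
     dom P \<subseteq> G \<and> ran P \<subseteq> B \<and> inj_on P (dom P) \<and>
     listed G Bl \<subseteq> dom P \<and> listed B Gl \<subseteq> ran P \<and>
     (\<forall>g \<in> listed G Bl. the (P g) \<in> Bl g) \<and>
     (\<forall>b \<in> listed B Gl. inv_into (dom P) P (Some b) \<in> Gl b)"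

end

theory Submission imports Defs begin

text \<open>
  Both matchings exist in a solution. For the converse, one seeks a set \<open>S\<close> of girls that are matched
  along \<open>T1\<close>, such that the boys of \<open>B\<^sub>L\<close> outside \<open>T1(S)\<close> can be matched along \<open>T2\<close>. The two parts
  fit together as soon as \<open>S = G\<^sub>L - T2(B\<^sub>L - T1(S))\<close>, and the right-hand side is monotone in \<open>S\<close>,
  as in the proof of the Schroeder--Bernstein theorem.
\<close>

text \<open>The last clause is what carries list constraints over to \<open>P\<close>: a property
  shared by all edges of \<open>f\<close> and of \<open>h\<close> holds for every edge of
  \<open>P\<close>.\<close>

lemma Mendelsohn_Dulmage:
  assumes f: "inj_on f X" and h: "inj_on h Y"
  obtains P where "inj_on P (dom P)" and "X \<subseteq> dom P" and "Y \<subseteq> ran P"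
    and "\<And>x y. P x = Some y \<Longrightarrow> x \<in> X \<and> y = f x \<or> y \<in> Y \<and> x = h y"
proof -
  have "mono (\<lambda>S. X - h ` (Y - f ` S))"
    by (rule monoI) blast
  \<comment> \<open>Any fixed point serves; from here on only the equation is used.\<close>
  from lfp_unfold[OF this] obtain S where S: "S = X - h ` (Y - f ` S)"
    by (elim that)
  define Z where "Z = Y - f ` S"
  \<comment> \<open>\<open>Z\<close> collects the points of \<open>Y\<close> missed by
    \<open>f\<close> on \<open>S\<close>; these are reached through \<open>h\<close> read
    backwards.\<close>
  define P where "P = (\<lambda>x. if x \<in> S then Some (f x)
    else if x \<in> h ` Z then Some (inv_into Z h x) else None)"
  have hZ: "inj_on h Z"
    using h by (rule inj_on_subset) (auto simp: Z_def)
  have disjoint: "S \<inter> h ` Z = {}" and cover: "X \<subseteq> S \<union> h ` Z" and "S \<subseteq> X"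
    using S unfolding Z_def by blast+
  have P_iff: "P x = Some y \<longleftrightarrow> x \<in> S \<and> y = f x \<or> y \<in> Z \<and> x = h y" for x y
    using disjoint hZ by (auto simp: P_def)
  show thesis
  proof
    show "inj_on P (dom P)"
    proof (rule inj_onI)
      fix x x' assume "x \<in> dom P" "P x = P x'"
      then obtain y where "P x = Some y" "P x' = Some y"
        by force
      then show "x = x'"
        using f \<open>S \<subseteq> X\<close> unfolding P_iff by (auto simp: Z_def dest: inj_onD)
    qed
    show "X \<subseteq> dom P"
      using cover by (auto simp: P_def dom_def)
    show "Y \<subseteq> ran P"
      by (auto simp: ran_def P_iff Z_def)
    show "x \<in> X \<and> y = f x \<or> y \<in> Y \<and> x = h y" if "P x = Some y" for x y
      using that \<open>S \<subseteq> X\<close> by (auto simp: P_iff Z_def)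
  qed
qed

lemma inv_into_dom_eq:
  assumes "inj_on P (dom P)" and "P x = Some y"
  shows "inv_into (dom P) P (Some y) = x"
  using inv_into_f_f[OF assms(1), of x] assms(2) by auto

text \<open>Every listed girl lies in \<open>dom P\<close> and every listed boy in
  \<open>ran P\<close>, and by injectivity each has exactly one edge. So \<open>the\<close> and
  \<open>inv_into\<close> denote genuine partners, and both list conditions become conditions on the
  edges of \<open>P\<close>.\<close>

lemma is_solution_iff:
  "is_solution G B Bl Gl P \<longleftrightarrow>
     dom P \<subseteq> G \<and> ran P \<subseteq> B \<and> inj_on P (dom P) \<and>
     listed G Bl \<subseteq> dom P \<and> listed B Gl \<subseteq> ran P \<and>
     (\<forall>g b. P g = Some b \<longrightarrow>
       (g \<in> listed G Bl \<longrightarrow> b \<in> Bl g) \<and> (b \<in> listed B Gl \<longrightarrow> g \<in> Gl b))"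
    (is "_ \<longleftrightarrow> ?D \<and> ?R \<and> ?I \<and> ?X \<and> ?Y \<and> ?E")
proof -
  have "(\<forall>g \<in> listed G Bl. the (P g) \<in> Bl g) \<and>
        (\<forall>b \<in> listed B Gl. inv_into (dom P) P (Some b) \<in> Gl b) \<longleftrightarrow> ?E"
    if inj: ?I and X: ?X and Y: ?Y
  proof -
    have "(\<forall>g \<in> listed G Bl. the (P g) \<in> Bl g) \<longleftrightarrow>
        (\<forall>g b. P g = Some b \<longrightarrow> g \<in> listed G Bl \<longrightarrow> b \<in> Bl g)"
      using X by force
    moreover have "(\<forall>b \<in> listed B Gl. inv_into (dom P) P (Some b) \<in> Gl b) \<longleftrightarrow>
        (\<forall>g b. P g = Some b \<longrightarrow> b \<in> listed B Gl \<longrightarrow> g \<in> Gl b)"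
      using Y inv_into_dom_eq[OF inj] by (fastforce simp: ran_def)
    ultimately show ?thesis
      by blast
  qed
  then show ?thesis
    unfolding is_solution_def by blast
qed

theorem theorem2:
  fixes G :: "'g set" and B :: "'b set"
    and Bl :: "'g \<Rightarrow> 'b set" and Gl :: "'b \<Rightarrow> 'g set"
  assumes "finite G" and "finite B"
    and "\<And>g. g \<in> G \<Longrightarrow> Bl g \<subseteq> B"
    and "\<And>b. b \<in> B \<Longrightarrow> Gl b \<subseteq> G"
  shows "(\<exists>P. is_solution G B Bl Gl P) \<longleftrightarrow>
    (\<exists>T1. T1 \<in> listed G Bl \<rightarrow> B \<and> inj_on T1 (listed G Bl) \<and>
          (\<forall>g \<in> listed G Bl. T1 g \<in> star Bl B Gl g)) \<and>
    (\<exists>T2. T2 \<in> listed B Gl \<rightarrow> G \<and> inj_on T2 (listed B Gl) \<and>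
          (\<forall>b \<in> listed B Gl. T2 b \<in> star Gl G Bl b))"
proof (intro iffI conjI; (elim exE conjE)?)
  fix P assume P: "is_solution G B Bl Gl P"
  let ?T1 = "\<lambda>g. the (P g)"
  let ?T2 = "\<lambda>b. inv_into (dom P) P (Some b)"
  have inj: "inj_on P (dom P)"
    and edge: "\<And>g b. P g = Some b \<Longrightarrow> g \<in> G \<and> b \<in> B \<and>
      (g \<in> listed G Bl \<longrightarrow> b \<in> Bl g) \<and> (b \<in> listed B Gl \<longrightarrow> g \<in> Gl b)"
    using P unfolding is_solution_iff by (auto intro: ranI)
  have T1: "P g = Some (?T1 g)" if "g \<in> listed G Bl" for g
    using that P unfolding is_solution_iff by force
  have T2: "P (?T2 b) = Some b" if "b \<in> listed B Gl" for b
  proof -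
    have "b \<in> ran P"
      using that P unfolding is_solution_iff by blast
    then have "Some b \<in> P ` dom P"
      by (force simp: ran_def)
    then show ?thesis
      by (rule f_inv_into_f)
  qed
  have "inj_on ?T1 (listed G Bl)"
    by (rule inj_onI) (metis T1 inj inj_onD domI)
  moreover have "?T1 g \<in> B \<and> ?T1 g \<in> star Bl B Gl g" if "g \<in> listed G Bl" for g
    using edge[OF T1[OF that]] that by (auto simp: star_def)
  ultimately show "\<exists>T1. T1 \<in> listed G Bl \<rightarrow> B \<and> inj_on T1 (listed G Bl) \<and>
      (\<forall>g \<in> listed G Bl. T1 g \<in> star Bl B Gl g)"
    by (intro exI[of _ ?T1]) blast
  \<comment> \<open>\<open>P\<close> recovers \<open>b\<close> from \<open>?T2 b\<close>, so
    \<open>?T2\<close> has a left inverse.\<close>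
  have "inj_on ?T2 (listed B Gl)"
    by (rule inj_onI) (metis T2 option.inject)
  moreover have "?T2 b \<in> G \<and> ?T2 b \<in> star Gl G Bl b" if "b \<in> listed B Gl" for b
    using edge[OF T2[OF that]] that by (auto simp: star_def)
  ultimately show "\<exists>T2. T2 \<in> listed B Gl \<rightarrow> G \<and> inj_on T2 (listed B Gl) \<and>
      (\<forall>b \<in> listed B Gl. T2 b \<in> star Gl G Bl b)"
    by (intro exI[of _ ?T2]) blast
next
  fix T1 T2
  assume T1: "T1 \<in> listed G Bl \<rightarrow> B" "inj_on T1 (listed G Bl)"
      "\<forall>g \<in> listed G Bl. T1 g \<in> star Bl B Gl g"
    and T2: "T2 \<in> listed B Gl \<rightarrow> G" "inj_on T2 (listed B Gl)"
      "\<forall>b \<in> listed B Gl. T2 b \<in> star Gl G Bl b"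
  obtain P where P: "inj_on P (dom P)" "listed G Bl \<subseteq> dom P" "listed B Gl \<subseteq> ran P"
    and edge: "\<And>g b. P g = Some b \<Longrightarrow>
      g \<in> listed G Bl \<and> b = T1 g \<or> b \<in> listed B Gl \<and> g = T2 b"
    using Mendelsohn_Dulmage[OF T1(2) T2(2)] by blast
  \<comment> \<open>Here \<open>star\<close> matters: an edge chosen from one side respects the
    list, if any, at its other end as well, so it may be kept whichever of \<open>T1\<close> and
    \<open>T2\<close> supplies it.\<close>
  have "g \<in> G \<and> b \<in> B \<and> (g \<in> listed G Bl \<longrightarrow> b \<in> Bl g) \<and> (b \<in> listed B Gl \<longrightarrow> g \<in> Gl b)"
    if "P g = Some b" for g b
    using edge[OF that] T1(1,3) T2(1,3) by (auto simp: star_def listed_def)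
  then have "is_solution G B Bl Gl P"
    using P unfolding is_solution_iff by (auto simp: ran_def)
  then show "\<exists>P. is_solution G B Bl Gl P"
    by blast
qed

end
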